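(* Let $G$ and $H$ be graphs such that $G$ is $(k_G,t_G)$-star colorable and $t_G\geq \chi(H)$. Then $\chi'_s(G\square H)\leq k_G+\chi'_s(H)$.
   Context: All graphs are finite, simple and undirected. A star edge coloring of a graph $G$ is a proper edge coloring such that no path or cycle with four edges in $G$ uses at most two colors; $\chi'_s(G)$ is the minimum number of colors in a star edge coloring of $G$, and $\chi(H)$ is the chromatic number. For an edge coloring $f$ and a vertex $v$, $A_f(v)$ denotes the set of colors of the edges incident to $v$. Two star edge colorings $f_1,f_2$ of $G$ are star compatible if $A_{f_1}(v)\cap A_{f_2}(v)=\emptyset$ for every vertex $v$. $G$ is $(k,t)$-star colorable if $G$ has $t$ pairwise star compatible star edge colorings $f_i:E(G)\to\{0,1,\ldots,k-1\}$, $1\le i\le t$. The Cartesian product $G\square H$ has vertex set $V(G)\times V(H)$, with $(a,x)(b,y)$ an edge iff either $ab\in E(G)$ and $x=y$, or $xy\in E(H)$ and $a=b$. *)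

theory Defs
  imports "Graph_Theory.Pair_Digraph"
begin

text \<open>
  A finite simple undirected graph is a \<^locale>\<open>pair_graph\<close>: a finite, loop-free, symmetric digraph
  without parallel arcs. An undirected edge is the unordered pair underlying the two opposite arcs
  \<open>(u, v)\<close> and \<open>(v, u)\<close>; edge colorings are functions on unordered pairs, of which only the values
  on edges matter.
\<close>

definition arc_edge :: "'a \<times> 'a \<Rightarrow> 'a set" where
  "arc_edge a = {fst a, snd a}"

definition edges :: "'a pair_pre_digraph \<Rightarrow> 'a set set" where
  "edges G = arc_edge ` parcs G"

definition proper_vertex_coloring :: "'a pair_pre_digraph \<Rightarrow> ('a \<Rightarrow> 'c) \<Rightarrow> bool" where
  "proper_vertex_coloring G c \<longleftrightarrow> (\<forall>u v. (u, v) \<in> parcs G \<longrightarrow> c u \<noteq> c v)"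

definition chromatic_number :: "'a pair_pre_digraph \<Rightarrow> nat" where
  "chromatic_number G =
    (LEAST k. \<exists>c :: 'a \<Rightarrow> nat. proper_vertex_coloring G c \<and> c ` pverts G \<subseteq> {..<k})"

definition proper_edge_coloring :: "'a pair_pre_digraph \<Rightarrow> ('a set \<Rightarrow> 'c) \<Rightarrow> bool" where
  "proper_edge_coloring G f \<longleftrightarrow>
    (\<forall>e \<in> edges G. \<forall>e' \<in> edges G. e \<noteq> e' \<and> e \<inter> e' \<noteq> {} \<longrightarrow> f e \<noteq> f e')"

text \<open>
  A closed walk of length two along an edge and back is a \<open>cycle\<close> of the library's symmetric
  digraphs; at length four, the cycles are exactly the cycles of the undirected graph.
\<close>

definition star_edge_coloring :: "'a pair_pre_digraph \<Rightarrow> ('a set \<Rightarrow> 'c) \<Rightarrow> bool" where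
  "star_edge_coloring G f \<longleftrightarrow>
    proper_edge_coloring G f \<and>
    (\<forall>p. length p = 4 \<and>
         ((\<exists>u v. pre_digraph.apath (with_proj G) u p v) \<or> pre_digraph.cycle (with_proj G) p)
       \<longrightarrow> \<not> card (f ` arc_edge ` set p) \<le> 2)"

definition star_chromatic_index :: "'a pair_pre_digraph \<Rightarrow> nat" where
  "star_chromatic_index G =
    (LEAST k. \<exists>f :: 'a set \<Rightarrow> nat. star_edge_coloring G f \<and> f ` edges G \<subseteq> {..<k})"

definition colors_at :: "'a pair_pre_digraph \<Rightarrow> ('a set \<Rightarrow> 'c) \<Rightarrow> 'a \<Rightarrow> 'c set" where
  "colors_at G f v = f ` {e \<in> edges G. v \<in> e}"

definition star_compatible ::
    "'a pair_pre_digraph \<Rightarrow> ('a set \<Rightarrow> 'c) \<Rightarrow> ('a set \<Rightarrow> 'c) \<Rightarrow> bool" where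
  "star_compatible G f g \<longleftrightarrow> (\<forall>v \<in> pverts G. colors_at G f v \<inter> colors_at G g v = {})"

definition star_colorable :: "'a pair_pre_digraph \<Rightarrow> nat \<Rightarrow> nat \<Rightarrow> bool" where
  "star_colorable G k t \<longleftrightarrow>
    (\<exists>f :: nat \<Rightarrow> 'a set \<Rightarrow> nat.
      (\<forall>i \<in> {1..t}. star_edge_coloring G (f i) \<and> f i ` edges G \<subseteq> {..<k}) \<and>
      (\<forall>i \<in> {1..t}. \<forall>j \<in> {1..t}. i \<noteq> j \<longrightarrow> star_compatible G (f i) (f j)))"

definition cartesian_product ::
    "'a pair_pre_digraph \<Rightarrow> 'b pair_pre_digraph \<Rightarrow> ('a \<times> 'b) pair_pre_digraph"
    (infixl \<open>\<square>\<close> 70) where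
  "G \<square> H =
    \<lparr> pverts = pverts G \<times> pverts H,
      parcs = {((a, x), (b, y)) | a x b y.
        ((a, b) \<in> parcs G \<and> x = y \<and> x \<in> pverts H) \<or>
        ((x, y) \<in> parcs H \<and> a = b \<and> a \<in> pverts G)} \<rparr>"

lemma pair_graph_cartesian_product:
  assumes "pair_graph G" and "pair_graph H"
  shows "pair_graph (G \<square> H)"
proof -
  interpret G: pair_graph G by fact
  interpret H: pair_graph H by fact
  have "parcs (G \<square> H) \<subseteq> (pverts G \<times> pverts H) \<times> (pverts G \<times> pverts H)"
    by (auto simp: cartesian_product_def dest: G.in_arcsD1 G.in_arcsD2 H.in_arcsD1 H.in_arcsD2)
  moreover have "finite (pverts G \<times> pverts H)"
    using G.pair_finite_verts H.pair_finite_verts by simp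
  ultimately have "finite (parcs (G \<square> H))"
    by (metis finite_cartesian_product finite_subset)
  then show ?thesis
    by unfold_locales
      (auto simp: cartesian_product_def symmetric_def sym_def G.pair_finite_verts H.pair_finite_verts
        intro: G.arcs_symmetric H.arcs_symmetric
        dest: G.in_arcsD1 G.in_arcsD2 H.in_arcsD1 H.in_arcsD2 G.pair_no_loops H.pair_no_loops)
qed

text \<open>The minima are attained on every graph: inject the vertices, respectively the edges, into
  the natural numbers.\<close>

lemma chromatic_number_attained:
  assumes "pair_graph G"
  shows "\<exists>c :: 'a \<Rightarrow> nat. proper_vertex_coloring (G :: 'a pair_pre_digraph) c \<and>
    c ` pverts G \<subseteq> {..<chromatic_number G}"
proof -
  interpret pair_graph G by fact
  obtain c :: "'a \<Rightarrow> nat" and n where c: "c ` pverts G = {i. i < n}" "inj_on c (pverts G)"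
    using finite_imp_inj_to_nat_seg[OF pair_finite_verts] by blast
  have "proper_vertex_coloring G c"
    unfolding proper_vertex_coloring_def
    using c(2) by (metis fst_conv snd_conv in_arcsD1 in_arcsD2 inj_onD pair_no_loops)
  with c(1) have "\<exists>c :: 'a \<Rightarrow> nat. proper_vertex_coloring G c \<and> c ` pverts G \<subseteq> {..<n}"
    by auto
  then show ?thesis
    unfolding chromatic_number_def
    by (rule LeastI[where P = "\<lambda>k. \<exists>c :: 'a \<Rightarrow> nat. proper_vertex_coloring G c \<and> c ` pverts G \<subseteq> {..<k}"])
qed

lemma star_edge_coloring_inj_on:
  assumes "pair_graph G" and inj: "inj_on f (edges G)"
  shows "star_edge_coloring G f"
proof -
  interpret pair_graph G by fact
  have proper: "proper_edge_coloring G f"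
    using inj by (auto simp: proper_edge_coloring_def inj_on_def)
  have "2 < card (f ` arc_edge ` set p)"
    if len: "length p = 4" and p: "(\<exists>u v. apath u p v) \<or> cycle p" for p
  proof -
    from len obtain e1 e2 e3 e4 where pe: "p = [e1, e2, e3, e4]"
      by (auto simp: numeral_eq_Suc length_Suc_conv)
    have sub: "set p \<subseteq> parcs G"
      using p by (auto simp: apath_def cycle_def awalk_def)
    obtain a b c d where abcd: "e1 = (a, b)" "e2 = (b, c)" "e3 = (c, d)" "distinct [a, b, c, d]"
    proof -
      obtain a b c d e where "e1 = (a, b)" "e2 = (b, c)" "e3 = (c, d)" "e4 = (d, e)"
        "distinct [a, b, c, d, e] \<or> e = a \<and> distinct [b, c, d, e]"
        using p unfolding pe
        by (cases e1; cases e2; cases e3; cases e4)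
          (auto simp: apath_def cycle_def awalk_def)
      then show ?thesis by (intro that[of a b c d]) auto
    qed
    have "card {{a, b}, {b, c}, {c, d}} = 3"
      using abcd(4) by (simp add: doubleton_eq_iff)
    moreover have "{{a, b}, {b, c}, {c, d}} \<subseteq> arc_edge ` set p"
      by (simp add: pe abcd(1-3) arc_edge_def)
    ultimately have "3 \<le> card (arc_edge ` set p)"
      by (metis card_mono finite_imageI List.finite_set)
    moreover have "card (f ` arc_edge ` set p) = card (arc_edge ` set p)"
      by (rule card_image, rule inj_on_subset[OF inj]) (use sub in \<open>auto simp: edges_def\<close>)
    ultimately show ?thesis by simp
  qed
  with proper show ?thesis
    unfolding star_edge_coloring_def by (auto simp: not_le)
qed

lemma star_chromatic_index_attained:
  assumes "pair_graph G"
  shows "\<exists>f :: 'a set \<Rightarrow> nat. star_edge_coloring (G :: 'a pair_pre_digraph) f \<and>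
    f ` edges G \<subseteq> {..<star_chromatic_index G}"
proof -
  interpret pair_graph G by fact
  have "finite (edges G)"
    unfolding edges_def using pair_finite_arcs by simp
  then obtain f :: "'a set \<Rightarrow> nat" and n where f: "f ` edges G = {i. i < n}" "inj_on f (edges G)"
    using finite_imp_inj_to_nat_seg[of "edges G"] by blast
  have "\<exists>f :: 'a set \<Rightarrow> nat. star_edge_coloring G f \<and> f ` edges G \<subseteq> {..<n}"
    using star_edge_coloring_inj_on[OF assms f(2)] f(1) by (intro exI[of _ f]) (simp add: lessThan_def)
  then show ?thesis
    unfolding star_chromatic_index_def
    by (rule LeastI[where P = "\<lambda>k. \<exists>f :: 'a set \<Rightarrow> nat. star_edge_coloring G f \<and> f ` edges G \<subseteq> {..<k}"])
qed

end

theory Submission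
  imports Defs
begin

text \<open>
  Color the copy of \<open>G\<close> over \<open>x\<close> with the star edge coloring selected by the color of \<open>x\<close> in a proper
  vertex coloring of \<open>H\<close>, and every copy of \<open>H\<close> with one star edge coloring in fresh colors. A
  bicolored path or cycle with four edges alternates its two colors. If both colors are old, or both
  are fresh, it lies in a single copy of \<open>G\<close> or of \<open>H\<close>. Otherwise it contains two equally colored
  \<open>G\<close>-edges joined by an \<open>H\<close>-edge, against the compatibility of the colorings over its two ends.
\<close>

lemma edges_iff: "e \<in> edges G \<longleftrightarrow> (\<exists>u v. (u, v) \<in> parcs G \<and> e = {u, v})"
  by (force simp: edges_def arc_edge_def)

lemma edgesI: "(u, v) \<in> parcs G \<Longrightarrow> {u, v} \<in> edges G"
  by (auto simp: edges_iff)

text \<open>With \<open>p\<close> and \<open>q\<close> different, a third color is avoided only if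
  \<open>r\<close> is \<open>p\<close>, since \<open>q\<close> is excluded, and then
  \<open>s\<close> is \<open>q\<close>. Along a properly colored walk this trades counting colors
  for two equations.\<close>

lemma card_le_two_alternating_iff:
  assumes "p \<noteq> q" "q \<noteq> r" "r \<noteq> s"
  shows "card {p, q, r, s} \<le> 2 \<longleftrightarrow> p = r \<and> q = s"
  using assms by (auto simp: card_insert_if)

text \<open>Two distinct edges that meet form a walk of two arcs that does not turn back. Stated on
  arcs, the condition can be checked on the product by cases on the kind of each arc.\<close>

lemma proper_edge_coloring_iff:
  assumes "pair_graph G"
  shows "proper_edge_coloring G f \<longleftrightarrow>
    (\<forall>a b c. (a, b) \<in> parcs G \<and> (b, c) \<in> parcs G \<and> a \<noteq> c \<longrightarrow> f {a, b} \<noteq> f {b, c})"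
    (is "?L \<longleftrightarrow> ?R")
proof
  assume L: ?L
  show ?R
  proof (intro allI impI, elim conjE)
    fix a b c assume *: "(a, b) \<in> parcs G" "(b, c) \<in> parcs G" "a \<noteq> c"
    then have "{a, b} \<in> edges G" "{b, c} \<in> edges G" "{a, b} \<noteq> {b, c}"
      by (auto simp: edges_iff doubleton_eq_iff)
    moreover have "{a, b} \<inter> {b, c} \<noteq> {}"
      by simp
    ultimately show "f {a, b} \<noteq> f {b, c}"
      using L[unfolded proper_edge_coloring_def, rule_format, of "{a, b}" "{b, c}"] by simp
  qed
next
  interpret pair_graph G by fact
  assume R: ?R
  \<comment> \<open>Symmetry of the arcs lets either edge be oriented towards the shared vertex
    \<open>w\<close>.\<close>
  have through: "\<exists>u. (u, w) \<in> parcs G \<and> e = {u, w}" if "e \<in> edges G" "w \<in> e" for e w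
  proof -
    from that(1) obtain u v where "(u, v) \<in> parcs G" and e: "e = {u, v}"
      unfolding edges_iff by blast
    moreover from this(1) have "(v, u) \<in> parcs G"
      by (rule arcs_symmetric)
    moreover from that(2) e have "w = u \<or> w = v"
      by simp
    ultimately show ?thesis by (auto simp: insert_commute)
  qed
  show ?L
    unfolding proper_edge_coloring_def
  proof (intro ballI impI, elim conjE)
    fix e e' assume e: "e \<in> edges G" "e' \<in> edges G" and ne: "e \<noteq> e'" "e \<inter> e' \<noteq> {}"
    from ne(2) obtain w where "w \<in> e" "w \<in> e'" by blast
    obtain u where "(u, w) \<in> parcs G" "e = {u, w}"
      using through[OF e(1) \<open>w \<in> e\<close>] by blast
    moreover obtain v where "(v, w) \<in> parcs G" "e' = {v, w}"
      using through[OF e(2) \<open>w \<in> e'\<close>] by blast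
    ultimately show "f e \<noteq> f e'"
      using R[rule_format, of u w v] ne(1) arcs_symmetric[of v w]
      by (auto simp: insert_commute)
  qed
qed

text \<open>In a proper coloring, an alternating walk with \<open>a = d\<close> or \<open>b = e\<close> would give equal colors to
  two edges of a triangle, so excluding backtracking is enough.\<close>

lemma star_edge_coloring_iff:
  assumes "pair_graph G"
  shows "star_edge_coloring G f \<longleftrightarrow> proper_edge_coloring G f \<and>
    (\<forall>a b c d e. (a, b) \<in> parcs G \<and> (b, c) \<in> parcs G \<and> (c, d) \<in> parcs G \<and> (d, e) \<in> parcs G \<and>
      a \<noteq> c \<and> b \<noteq> d \<and> c \<noteq> e \<longrightarrow> \<not> (f {a, b} = f {c, d} \<and> f {b, c} = f {d, e}))"
    (is "_ \<longleftrightarrow> _ \<and> ?R")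
proof (cases "proper_edge_coloring G f")
  case False
  then show ?thesis by (simp add: star_edge_coloring_def)
next
  interpret pair_graph G by fact
  case True
  then have proper: "f {a, b} \<noteq> f {b, c}"
    if "(a, b) \<in> parcs G" "(b, c) \<in> parcs G" "a \<noteq> c" for a b c
    using that proper_edge_coloring_iff[OF assms] by blast
  have "star_edge_coloring G f \<longleftrightarrow> ?R"
  proof
    assume star: "star_edge_coloring G f"
    show ?R
    proof (intro allI impI notI, elim conjE)
      fix a b c d e
      assume arcs: "(a, b) \<in> parcs G" "(b, c) \<in> parcs G" "(c, d) \<in> parcs G" "(d, e) \<in> parcs G"
        and ne: "a \<noteq> c" "b \<noteq> d" "c \<noteq> e" and f: "f {a, b} = f {c, d}" "f {b, c} = f {d, e}"
      have loop: "a \<noteq> b" "b \<noteq> c" "c \<noteq> d" "d \<noteq> e"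
        using arcs no_loops' by auto
      have "a \<noteq> d"
        using proper[of c a b] arcs f(1) loop(2) by (auto simp: insert_commute)
      moreover have "b \<noteq> e"
        using proper[of d b c] arcs f(2) loop(3) by (auto simp: insert_commute)
      moreover have "a \<in> pverts G" "e \<in> pverts G" "b \<in> pverts G" "c \<in> pverts G" "d \<in> pverts G"
        using arcs in_arcsD1 in_arcsD2 by blast+
      \<comment> \<open>The only coincidence left among the five vertices is \<open>a = e\<close>,
        which decides between cycle and path.\<close>
      ultimately have
        "(\<exists>u v. apath u [(a, b), (b, c), (c, d), (d, e)] v) \<or> cycle [(a, b), (b, c), (c, d), (d, e)]"
        using arcs loop ne
        by (cases "a = e") (auto simp: apath_def cycle_def awalk_def)
      moreover have "length [(a, b), (b, c), (c, d), (d, e)] = 4"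
        by simp
      ultimately have "\<not> card (f ` arc_edge ` set [(a, b), (b, c), (c, d), (d, e)]) \<le> 2"
        using star unfolding star_edge_coloring_def by blast
      then have "\<not> card {f {a, b}, f {b, c}, f {c, d}, f {d, e}} \<le> 2"
        by (simp add: arc_edge_def)
      with f show False
        using card_le_two_alternating_iff proper arcs ne by metis
    qed
  next
    assume R: ?R
    have "\<not> card (f ` arc_edge ` set p) \<le> 2"
      if len: "length p = 4" and p: "(\<exists>u v. apath u p v) \<or> cycle p" for p
    proof -
      from len obtain e1 e2 e3 e4 where pe: "p = [e1, e2, e3, e4]"
        by (auto simp: numeral_eq_Suc length_Suc_conv)
      \<comment> \<open>A path has five distinct vertices; a cycle has \<open>e = a\<close> and the
        last four distinct. Neither turns back.\<close>
      obtain a b c d e where es: "e1 = (a, b)" "e2 = (b, c)" "e3 = (c, d)" "e4 = (d, e)"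
        and ne: "a \<noteq> c" "b \<noteq> d" "c \<noteq> e"
        using p unfolding pe
        by (cases e1; cases e2; cases e3; cases e4)
          (auto simp: apath_def cycle_def awalk_def)
      have arcs: "(a, b) \<in> parcs G" "(b, c) \<in> parcs G" "(c, d) \<in> parcs G" "(d, e) \<in> parcs G"
        using p by (auto simp: apath_def cycle_def awalk_def pe es)
      have "\<not> card {f {a, b}, f {b, c}, f {c, d}, f {d, e}} \<le> 2"
        using card_le_two_alternating_iff proper arcs ne R by metis
      then show ?thesis
        by (simp add: pe es arc_edge_def)
    qed
    with True show "star_edge_coloring G f"
      unfolding star_edge_coloring_def by blast
  qed
  with True show ?thesis by simp
qed

lemma star_edge_coloring_adjacentD:
  assumes "pair_graph G" "star_edge_coloring G f"
    and "(a, b) \<in> parcs G" "(b, c) \<in> parcs G" "a \<noteq> c"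
  shows "f {a, b} \<noteq> f {b, c}"
proof -
  have "proper_edge_coloring G f"
    using assms(2) by (simp add: star_edge_coloring_def)
  with proper_edge_coloring_iff[OF assms(1), of f] assms(3-) show ?thesis by simp
qed

lemma star_edge_coloring_alternatingD:
  assumes "pair_graph G" "star_edge_coloring G f"
    and "(a, b) \<in> parcs G" "(b, c) \<in> parcs G" "(c, d) \<in> parcs G" "(d, e) \<in> parcs G"
    and "a \<noteq> c" "b \<noteq> d" "c \<noteq> e" "f {a, b} = f {c, d}"
  shows "f {b, c} \<noteq> f {d, e}"
  using assms(2-) star_edge_coloring_iff[OF assms(1), of f] by simp

text \<open>Both colors occur at \<open>b\<close>. The case \<open>a = c\<close> is allowed on
  purpose: a walk in the product may cross an edge of \<open>G\<close>, change copy and return over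
  the same edge.\<close>

lemma star_compatibleD:
  assumes "pair_graph G" "star_compatible G f g" "(a, b) \<in> parcs G" "(b, c) \<in> parcs G"
  shows "f {a, b} \<noteq> g {b, c}"
proof -
  interpret pair_graph G by fact
  have "f {a, b} \<in> colors_at G f b" "g {b, c} \<in> colors_at G g b"
    using assms(3,4) by (auto simp: colors_at_def dest: edgesI)
  moreover have "b \<in> pverts G"
    using assms(3) in_arcsD2 by blast
  ultimately show ?thesis
    using assms(2) unfolding star_compatible_def by (metis disjoint_iff)
qed

lemma product_arc_cases:
  assumes "(u, v) \<in> parcs (G \<square> H)"
  obtains (G) a b x where "u = (a, x)" "v = (b, x)" "(a, b) \<in> parcs G" "x \<in> pverts H"
    | (H) a x y where "u = (a, x)" "v = (a, y)" "(x, y) \<in> parcs H" "a \<in> pverts G"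
  using assms by (auto simp: cartesian_product_def)

text \<open>The kind of an unordered pair is read off its projection to \<open>H\<close>: one vertex
  \<open>x\<close> for an edge of the copy of \<open>G\<close> over \<open>x\<close>, two vertices
  for an edge of a copy of \<open>H\<close>. The shift by \<open>k\<close> keeps the colors of
  \<open>h\<close> apart from old colors below \<open>k\<close>.\<close>

definition product_coloring ::
    "('b \<Rightarrow> 'a set \<Rightarrow> nat) \<Rightarrow> nat \<Rightarrow> ('b set \<Rightarrow> nat) \<Rightarrow> ('a \<times> 'b) set \<Rightarrow> nat" where
  "product_coloring g k h e =
    (if is_singleton (snd ` e) then g (the_elem (snd ` e)) (fst ` e) else k + h (snd ` e))"

lemma product_coloring_G: "product_coloring g k h {(a, x), (b, x)} = g x {a, b}"
  by (simp add: product_coloring_def)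

lemma product_coloring_H: "x \<noteq> y \<Longrightarrow> product_coloring g k h {(a, x), (a, y)} = k + h {x, y}"
  by (simp add: product_coloring_def is_singleton_def doubleton_eq_iff)

text \<open>Compatibility is asked for only along arcs of \<open>H\<close>, because in an
  alternating walk of mixed kinds a single \<open>H\<close>-edge separates two
  \<open>G\<close>-edges.\<close>

lemma star_edge_coloring_product:
  assumes G: "pair_graph G" and H: "pair_graph H"
    and g: "\<And>x. x \<in> pverts H \<Longrightarrow> star_edge_coloring G (g x) \<and> g x ` edges G \<subseteq> {..<k}"
    and compat: "\<And>x y. (x, y) \<in> parcs H \<Longrightarrow> star_compatible G (g x) (g y)"
    and h: "star_edge_coloring H h"
  shows "star_edge_coloring (G \<square> H) (product_coloring g k h)" (is "star_edge_coloring _ ?F")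
proof -
  interpret H: pair_graph H by fact
  note GH = pair_graph_cartesian_product[OF G H]
  have loop: "x \<noteq> y" if "(x, y) \<in> parcs H" for x y
    using H.no_loops'[OF that] .
  have less: "g x {a, b} < k" if "x \<in> pverts H" "(a, b) \<in> parcs G" for x a b
    using g[OF that(1)] edgesI[OF that(2)] by (auto simp: image_subset_iff)
  have less_H: "g x {a, b} \<noteq> k + n" if "x \<in> pverts H" "(a, b) \<in> parcs G" for x a b n
    using less[OF that] by simp
  note G_star = conjunct1[OF g]
  note proper = star_edge_coloring_adjacentD[OF G G_star] star_edge_coloring_adjacentD[OF H h]
  note alternating =
    star_edge_coloring_alternatingD[OF G G_star] star_edge_coloring_alternatingD[OF H h]
  have compatGH: "g x {a, b} \<noteq> g y {b, c}"
    if "(x, y) \<in> parcs H" "(a, b) \<in> parcs G" "(b, c) \<in> parcs G" for x y a b c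
    using star_compatibleD[OF G compat[OF that(1)] that(2,3)] .
  note F = product_coloring_G product_coloring_H[OF loop]
  have "proper_edge_coloring (G \<square> H) ?F"
    unfolding proper_edge_coloring_iff[OF GH]
  proof (intro allI impI, elim conjE)
    fix p q r assume "(p, q) \<in> parcs (G \<square> H)" "(q, r) \<in> parcs (G \<square> H)" "p \<noteq> r"
    then show "?F {p, q} \<noteq> ?F {q, r}"
      \<comment> \<open>Consecutive arcs of the same kind stay in one copy, which is properly
        colored; for different kinds exactly one color is below \<open>k\<close>.\<close>
      by (elim product_arc_cases; simp add: F less_H less_H[symmetric] proper)
  qed
  moreover have "\<not> (?F {p, q} = ?F {r, s} \<and> ?F {q, r} = ?F {s, t})"
    if "(p, q) \<in> parcs (G \<square> H)" "(q, r) \<in> parcs (G \<square> H)" "(r, s) \<in> parcs (G \<square> H)"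
      "(s, t) \<in> parcs (G \<square> H)" "p \<noteq> r" "q \<noteq> s" "r \<noteq> t" for p q r s t
    using that
    \<comment> \<open>Of the sixteen patterns of kinds, the simplifier refutes all mixed ones:
      \<open>less_H\<close> if arcs two apart differ in kind, \<open>compatGH\<close> if kinds
      alternate. The walks inside one copy of \<open>G\<close> or of \<open>H\<close>
      remain.\<close>
    apply (elim product_arc_cases)
    apply (simp_all add: F less_H less_H[symmetric] compatGH)
    subgoal by (rule impI, rule alternating(1), assumption+)
    subgoal by (rule impI, rule alternating(2), assumption+)
    done
  ultimately show ?thesis
    unfolding star_edge_coloring_iff[OF GH] by blast
qed

lemma product_coloring_range:
  assumes H: "pair_graph H"
    and g: "\<And>x. x \<in> pverts H \<Longrightarrow> g x ` edges G \<subseteq> {..<k}"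
    and h: "h ` edges H \<subseteq> {..<m}"
  shows "product_coloring g k h ` edges (G \<square> H) \<subseteq> {..<k + m}"
proof
  interpret H: pair_graph H by fact
  fix n assume "n \<in> product_coloring g k h ` edges (G \<square> H)"
  then obtain u v where uv: "(u, v) \<in> parcs (G \<square> H)" and n: "n = product_coloring g k h {u, v}"
    by (auto simp: edges_iff)
  from uv show "n \<in> {..<k + m}"
  proof (cases rule: product_arc_cases)
    case (G a b x)
    then have "g x {a, b} < k"
      using g[of x] by (auto simp: image_subset_iff dest: edgesI)
    with G show ?thesis by (simp add: n product_coloring_G)
  next
    case (H a x y)
    then have "h {x, y} < m"
      using h by (auto simp: image_subset_iff dest: edgesI)
    moreover have "x \<noteq> y"
      using H.no_loops'[OF H(3)] .
    ultimately show ?thesis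
      using H by (simp add: n product_coloring_H)
  qed
qed

theorem theorem2:
  fixes G :: "'a pair_pre_digraph" and H :: "'b pair_pre_digraph" and k\<^sub>G t\<^sub>G :: nat
  assumes "pair_graph G" and "pair_graph H"
    and "star_colorable G k\<^sub>G t\<^sub>G"
    and "t\<^sub>G \<ge> chromatic_number H"
  shows "star_chromatic_index (G \<square> H) \<le> k\<^sub>G + star_chromatic_index H"
proof -
  interpret H: pair_graph H by fact
  from assms(3) obtain f :: "nat \<Rightarrow> 'a set \<Rightarrow> nat" where
    f: "\<forall>i \<in> {1..t\<^sub>G}. star_edge_coloring G (f i) \<and> f i ` edges G \<subseteq> {..<k\<^sub>G}"
    and compat: "\<forall>i \<in> {1..t\<^sub>G}. \<forall>j \<in> {1..t\<^sub>G}. i \<noteq> j \<longrightarrow> star_compatible G (f i) (f j)"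
    unfolding star_colorable_def by blast
  obtain c :: "'b \<Rightarrow> nat" where c: "proper_vertex_coloring H c"
    and c_range: "c ` pverts H \<subseteq> {..<chromatic_number H}"
    using chromatic_number_attained[OF assms(2)] by blast
  obtain h :: "'b set \<Rightarrow> nat" where h: "star_edge_coloring H h"
    and h_range: "h ` edges H \<subseteq> {..<star_chromatic_index H}"
    using star_chromatic_index_attained[OF assms(2)] by blast
  \<comment> \<open>Vertex colors start at 0, while the family \<open>f\<close> is indexed from 1;
    hence \<open>Suc\<close>.\<close>
  define g where "g x = f (Suc (c x))" for x
  have index: "Suc (c x) \<in> {1..t\<^sub>G}" if "x \<in> pverts H" for x
    using c_range assms(4) that by fastforce
  have g: "star_edge_coloring G (g x) \<and> g x ` edges G \<subseteq> {..<k\<^sub>G}" if "x \<in> pverts H" for x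
    using f index[OF that] unfolding g_def by blast
  have g_compat: "star_compatible G (g x) (g y)" if "(x, y) \<in> parcs H" for x y
  proof -
    have "c x \<noteq> c y"
      using c that by (simp add: proper_vertex_coloring_def)
    moreover have "x \<in> pverts H" "y \<in> pverts H"
      using that H.in_arcsD1 H.in_arcsD2 by blast+
    ultimately show ?thesis
      using compat index unfolding g_def by (metis Suc_inject)
  qed
  have "star_edge_coloring (G \<square> H) (product_coloring g k\<^sub>G h)"
    using star_edge_coloring_product[OF assms(1,2) g g_compat h] .
  moreover have
    "product_coloring g k\<^sub>G h ` edges (G \<square> H) \<subseteq> {..<k\<^sub>G + star_chromatic_index H}"
    using product_coloring_range[OF assms(2) _ h_range] g by blast
  ultimately show ?thesis
    unfolding star_chromatic_index_def[of "G \<square> H"] by (intro Least_le) blast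
qed

end
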